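(* Let $n\ge 1$ be an integer and let $K\subseteq\mathbb{R}^n$ be a convex body. Then the entropic barrier $f^\star:\operatorname{int}K\to\mathbb{R}$ on $K$ is an $n$-self-concordant barrier, i.e. $$\nabla^2 f^\star(x)\succeq \frac1n\,\nabla f^\star(x)\,\nabla f^\star(x)^{\mathsf T}\qquad\text{for all } x\in\operatorname{int}K.$$
   Context: A convex body $K\subseteq\mathbb{R}^n$ is a compact convex set with nonempty interior $\operatorname{int}K$. Define $f:\mathbb{R}^n\to\mathbb{R}$ by $$f(\theta):=\ln\int_K \exp\langle\theta,x\rangle\,dx,$$ where $dx$ is Lebesgue measure and $\langle\cdot,\cdot\rangle$ is the Euclidean inner product. The entropic barrier on $K$ is the Fenchel conjugate of $f$, restricted to $\operatorname{int}K$: $$f^\star(x):=\sup_{\theta\in\mathbb{R}^n}\{\langle\theta,x\rangle-f(\theta)\},\qquad x\in\operatorname{int}K.$$ For $\nu>0$, a twice differentiable function $\phi:\operatorname{int}K\to\mathbb{R}$ is called a $\nu$-self-concordant barrier if $\nabla^2\phi(x)\succeq\frac1\nu\nabla\phi(x)\nabla\phi(x)^{\mathsf T}$ for all $x\in\operatorname{int}K$. Here $\nabla$ and $\nabla^2$ denote the gradient and Hessian, and $A\succeq B$ means that $A-B$ is positive semidefinite. *)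

theory Defs
  imports "HOL-Analysis.Analysis"
begin

definition convex_body :: "(real ^ 'n) set \<Rightarrow> bool" where
  "convex_body K \<longleftrightarrow> compact K \<and> convex K \<and> interior K \<noteq> {}"

definition log_laplace :: "(real ^ 'n) set \<Rightarrow> real ^ 'n \<Rightarrow> real" where
  "log_laplace K \<theta> = ln (LINT x:K|lborel. exp (\<theta> \<bullet> x))"

text \<open>The supremum is taken in the extended reals, so that it is meaningful also where it is
  infinite.\<close>

definition fenchel_conjugate :: "(real ^ 'n \<Rightarrow> real) \<Rightarrow> real ^ 'n \<Rightarrow> ereal" where
  "fenchel_conjugate f x = (SUP \<theta>. ereal (\<theta> \<bullet> x - f \<theta>))"

text \<open>The entropic barrier is meant on the interior of \<open>K\<close> only. Elsewhere, and in general
  wherever the conjugate is infinite, \<^const>\<open>real_of_ereal\<close> returns the dummy value \<open>0\<close>.\<close>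

definition entropic_barrier :: "(real ^ 'n) set \<Rightarrow> real ^ 'n \<Rightarrow> real" where
  "entropic_barrier K x = real_of_ereal (fenchel_conjugate (log_laplace K) x)"

definition gradient :: "(real ^ 'n \<Rightarrow> real) \<Rightarrow> real ^ 'n \<Rightarrow> real ^ 'n" where
  "gradient f x = (THE D. GDERIV f x :> D)"

lemma GDERIV_gradient:
  assumes "f differentiable (at x)"
  shows "GDERIV f x :> gradient f x"
proof -
  obtain f' where f': "(f has_derivative f') (at x)"
    using assms by (auto simp: differentiable_def)
  then have lin: "linear f'"
    by (rule has_derivative_linear)
  have "f' = (\<lambda>h. h \<bullet> adjoint f' 1)"
    using adjoint_works[OF lin] by (auto simp: fun_eq_iff)
  then have D: "GDERIV f x :> adjoint f' 1"
    using f' by (simp add: gderiv_def)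
  have "E = adjoint f' 1" if "GDERIV f x :> E" for E
  proof -
    have "(\<lambda>h. h \<bullet> E) = (\<lambda>h. h \<bullet> adjoint f' 1)"
      using has_derivative_unique that D unfolding gderiv_def by blast
    then show ?thesis
      by (metis vector_eq_rdot inner_commute)
  qed
  with D show ?thesis
    unfolding gradient_def by (rule theI)
qed

text \<open>The entry of the Hessian in row \<open>i\<close> and column \<open>j\<close> is the partial derivative in direction
  \<open>j\<close> of the \<open>i\<close>-th component of the gradient.\<close>

definition hessian :: "(real ^ 'n \<Rightarrow> real) \<Rightarrow> real ^ 'n \<Rightarrow> real ^ 'n ^ 'n" where
  "hessian f x = jacobian (gradient f) (at x)"

text \<open>Intended for open \<open>S\<close>; the derivatives are full derivatives, not derivatives within \<open>S\<close>.\<close>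

definition twice_differentiable_on :: "(real ^ 'n \<Rightarrow> real) \<Rightarrow> (real ^ 'n) set \<Rightarrow> bool" where
  "twice_differentiable_on f S \<longleftrightarrow>
     (\<forall>x\<in>S. f differentiable (at x) \<and> gradient f differentiable (at x))"

definition positive_semidefinite :: "real ^ 'n ^ 'n \<Rightarrow> bool" where
  "positive_semidefinite A \<longleftrightarrow> transpose A = A \<and> (\<forall>v. 0 \<le> v \<bullet> (A *v v))"

text \<open>The annotations matter: \<^const>\<open>columnvector\<close> and \<^const>\<open>rowvector\<close> are polymorphic in
  the repeated dimension, which has to be one here.\<close>

definition outer_product :: "real ^ 'n \<Rightarrow> real ^ 'n \<Rightarrow> real ^ 'n ^ 'n" where
  "outer_product u v = (columnvector u :: real ^ 1 ^ 'n) ** (rowvector v :: real ^ 'n ^ 1)"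

lemma outer_product_nth: "outer_product u v $ i $ j = u $ i * v $ j"
  by (simp add: outer_product_def matrix_matrix_mult_def columnvector_def rowvector_def)

definition self_concordant_barrier ::
    "real \<Rightarrow> (real ^ 'n) set \<Rightarrow> (real ^ 'n \<Rightarrow> real) \<Rightarrow> bool" where
  "self_concordant_barrier \<nu> S \<phi> \<longleftrightarrow>
     0 < \<nu> \<and> twice_differentiable_on \<phi> S \<and>
     (\<forall>x\<in>S. positive_semidefinite
        (hessian \<phi> x -
          (1 / \<nu>) *\<^sub>R outer_product (gradient \<phi> x) (gradient \<phi> x)))"

end

theory Submission
  imports Defs
begin

text \<open>
  Write \<open>Z \<theta>\<close> for the integral of \<open>exp (\<theta> \<bullet> x)\<close> over \<open>K\<close>, and call the probability density on \<open>K\<close>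
  proportional to \<open>exp (\<theta> \<bullet> x)\<close> the density tilted by \<open>\<theta>\<close>. The gradient and the Hessian of \<open>ln Z\<close>
  are the mean and the covariance of the tilted density. The covariance is positive definite, so the
  mean is injective as a function of \<open>\<theta>\<close>; by coercivity the supremum in the conjugate is attained at
  every interior \<open>x\<close>, namely at the \<open>\<theta>\<close> whose tilted mean is \<open>x\<close>. Hence the barrier is finite, its
  gradient at \<open>x\<close> is this \<open>\<theta>\<close>, and by the inverse function rule its Hessian is the inverse of the
  covariance.

  The claim is therefore that the inverse covariance dominates \<open>\<theta>\<close> times its transpose divided by
  the dimension. By Cauchy--Schwarz for the covariance (\<open>inverse_covariance_ge\<close>) it follows from the
  statement that the variance of \<open>\<theta> \<bullet> x\<close> under the density tilted by \<open>\<theta>\<close> is at most the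
  dimension (\<open>covariance_le_DIM\<close>). With \<open>n\<close> the dimension, \<open>t ^ n * Z (t \<theta>)\<close> is the
  integral of \<open>exp (\<theta> \<bullet> y)\<close> over the dilate \<open>t K\<close>. These integrals are the marginals
  in \<open>t\<close> of a log-concave function on the convex cone of all \<open>(t, y)\<close> with \<open>y\<close> in \<open>t K\<close>, so by the Prekopa--Leindler inequality they are log-concave in
  \<open>t\<close>. The second derivative of the logarithm at \<open>t = 1\<close> is the variance minus \<open>n\<close>, and it cannot
  be positive.

  The Prekopa--Leindler inequality is used for midpoints. It is proved on the real line by
  comparing level sets, and extended to higher dimensions by Fubini (\<open>prekopa_leindler\<close>).
\<close>

section \<open>The Prekopa--Leindler inequality\<close>

text \<open>The one-dimensional Brunn--Minkowski inequality, halved. If \<open>a\<close> is almost the largest point of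
  \<open>A\<close> and \<open>b\<close> almost the smallest point of \<open>B\<close>, then the translates \<open>A + b\<close> and \<open>a + B\<close> both lie
  in \<open>2 C\<close>, the first to the left of the second except for a short overlap.\<close>
lemma midpoint_set_measure:
  fixes A B C :: "real set"
  assumes [measurable]: "A \<in> sets borel" "B \<in> sets borel" "C \<in> sets borel"
    and ne: "A \<noteq> {}" "B \<noteq> {}" and bd: "bounded A" "bounded B"
    and mid: "\<And>a b. a \<in> A \<Longrightarrow> b \<in> B \<Longrightarrow> (a + b) / 2 \<in> C"
  shows "emeasure lborel A + emeasure lborel B \<le> 2 * emeasure lborel C"
proof (rule ennreal_le_epsilon)
  fix e :: real assume e: "0 < e"
  have bdd: "bdd_above A" "bdd_below B"
    using bd by (simp_all add: bounded_imp_bdd_above bounded_imp_bdd_below)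
  obtain a where a: "a \<in> A" "Sup A - e / 2 < a"
    using less_cSupE[of "Sup A - e / 2" A] ne(1) e by auto
  obtain b where b: "b \<in> B" "b < Inf B + e / 2"
    using cInf_lessD[of B "Inf B + e / 2"] ne(2) e by auto
  let ?A = "{z. z - b \<in> A}" and ?B = "{z. z - a \<in> B}"
  have translate: "emeasure lborel {z. z - c \<in> S} = emeasure lborel S"
    if [measurable]: "S \<in> sets borel" for S :: "real set" and c
  proof -
    have "emeasure lborel S = emeasure (distr lborel borel ((+) (- c))) S"
      by (simp only: lborel_distr_plus)
    also have "\<dots> = emeasure lborel {z. z - c \<in> S}"
      by (subst emeasure_distr) (auto simp: vimage_def)
    finally show ?thesis by simp
  qed
  have dilate: "emeasure lborel {z. z / 2 \<in> C} = 2 * emeasure lborel C"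
    using nn_integral_real_affine[of "indicator {z. z / 2 \<in> C}" 2 0]
    by (simp add: indicator_def [abs_def] flip: nn_integral_indicator)
  have "emeasure lborel A + emeasure lborel B = emeasure lborel ?A + emeasure lborel ?B"
    by (simp add: translate)
  also have "\<dots> = emeasure lborel (?A \<union> ?B) + emeasure lborel (?A \<inter> ?B)"
    by (rule emeasure_Un_Int) simp_all
  also have "\<dots> \<le> emeasure lborel {z. z / 2 \<in> C} + emeasure lborel {a + Inf B .. Sup A + b}"
  proof (intro add_mono emeasure_mono)
    show "?A \<union> ?B \<subseteq> {z. z / 2 \<in> C}"
      using mid[OF _ b(1)] mid[OF a(1)] by fastforce
    show "?A \<inter> ?B \<subseteq> {a + Inf B .. Sup A + b}"
      using cSup_upper[OF _ bdd(1)] cInf_lower[OF _ bdd(2)] by fastforce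
  qed simp_all
  also have "emeasure lborel {a + Inf B .. Sup A + b} \<le> ennreal e"
    using a(2) b(2) e by (cases "a + Inf B \<le> Sup A + b") (auto intro!: ennreal_leI)
  finally show "emeasure lborel A + emeasure lborel B \<le> 2 * emeasure lborel C + ennreal e"
    by (simp add: dilate)
qed

text \<open>Tonelli for the region under the graph of \<open>f\<close>. Levels from \<open>1\<close> on contribute nothing, and
  cutting them off keeps the level sets of a function with supremum \<open>1\<close> nonempty.\<close>
lemma nn_integral_layer_cake:
  fixes f :: "'a \<Rightarrow> ennreal"
  assumes "sigma_finite_measure M" and [measurable]: "f \<in> borel_measurable M"
    and le1: "\<And>x. f x \<le> 1"
  shows "(\<integral>\<^sup>+x. f x \<partial>M) = (\<integral>\<^sup>+t\<in>{0..<1}. emeasure M {x\<in>space M. ennreal t < f x} \<partial>lborel)"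
proof -
  interpret M: sigma_finite_measure M by fact
  interpret P: pair_sigma_finite M lborel ..
  have "f x = (\<integral>\<^sup>+t. indicator {0..<1} t * indicator {y\<in>space M. ennreal t < f y} x \<partial>lborel)"
    if "x \<in> space M" for x
  proof -
    obtain r where r: "0 \<le> r" "r \<le> 1" "f x = ennreal r"
      using le1[of x] by (cases "f x") (auto simp: top_unique)
    have "(\<integral>\<^sup>+t. indicator {0..<1} t * indicator {y\<in>space M. ennreal t < f y} x \<partial>lborel)
        = (\<integral>\<^sup>+t. indicator {0..<r} t \<partial>lborel)"
      using that r by (intro nn_integral_cong) (auto simp: indicator_def ennreal_less_iff)
    then show ?thesis using r by simp
  qed
  then have "(\<integral>\<^sup>+x. f x \<partial>M) =
      (\<integral>\<^sup>+x. (\<integral>\<^sup>+t. indicator {0..<1} t * indicator {y\<in>space M. ennreal t < f y} x \<partial>lborel) \<partial>M)"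
    by (intro nn_integral_cong)
  also have "\<dots> = (\<integral>\<^sup>+t. (\<integral>\<^sup>+x. indicator {0..<1} t * indicator {y\<in>space M. ennreal t < f y} x \<partial>M) \<partial>lborel)"
    by (rule P.Fubini'[symmetric]) measurable
  also have "\<dots> = (\<integral>\<^sup>+t\<in>{0..<1}. emeasure M {x\<in>space M. ennreal t < f x} \<partial>lborel)"
    by (intro nn_integral_cong) (simp add: nn_integral_cmult mult.commute)
  finally show ?thesis .
qed

lemma level_set_midpoint:
  fixes s a b c :: ennreal
  assumes "s < a" "s < b" "a * b \<le> c\<^sup>2" "s < top"
  shows "s < c"
proof (rule ccontr)
  assume "\<not> s < c"
  then have "c * c \<le> s * s" by (intro mult_mono) auto
  moreover have "s * s < a * b"
  proof (cases "b = top")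
    case True
    have "a * b = top" using assms(1) True by (auto simp: ennreal_mult_top)
    then show ?thesis using assms(4) by (simp add: ennreal_mult_less_top)
  next
    case False
    have "s * s \<le> s * b" using assms(2) by (intro mult_left_mono) auto
    also have "\<dots> < a * b"
      using assms(1) False le_less_trans[OF zero_le assms(2)]
      by (intro ennreal_mult_strict_right_mono) (auto simp: less_top)
    finally show ?thesis .
  qed
  ultimately show False using assms(3) by (auto simp: power2_eq_square)
qed

text \<open>With equal suprema, the level sets of \<open>f\<close> and \<open>g\<close> are nonempty at the same levels, so the
  inequality for midpoints of sets applies at each level; integrating over the levels even gives
  the arithmetic mean of the two integrals as a lower bound. Without the normalization one of the
  two sets could be empty, and the set inequality would fail.\<close>
lemma prekopa_leindler_normalized:
  fixes f g h :: "real \<Rightarrow> ennreal"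
  assumes [measurable]: "f \<in> borel_measurable borel" "g \<in> borel_measurable borel"
      "h \<in> borel_measurable borel"
    and sup: "(SUP x. f x) = 1" "(SUP x. g x) = 1"
    and bd: "bounded {x. f x \<noteq> 0}" "bounded {x. g x \<noteq> 0}"
    and mid: "\<And>x y. f x * g y \<le> (h ((x + y) / 2))\<^sup>2"
  shows "(\<integral>\<^sup>+x. f x \<partial>lborel) + (\<integral>\<^sup>+x. g x \<partial>lborel) \<le> 2 * (\<integral>\<^sup>+x. h x \<partial>lborel)"
proof -
  have le1: "f x \<le> 1" "g x \<le> 1" for x
    using sup by (metis SUP_upper UNIV_I)+
  let ?l = "\<lambda>u t. emeasure lborel {x. ennreal t < u x} * indicator {0..<1} t"
  have cake: "(\<integral>\<^sup>+x. u x \<partial>lborel) = (\<integral>\<^sup>+t. ?l u t \<partial>lborel)"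
    if "u \<in> borel_measurable borel" "\<And>x. u x \<le> 1" for u :: "real \<Rightarrow> ennreal"
    using nn_integral_layer_cake[OF lborel.sigma_finite_measure_axioms, of u] that by simp
  let ?h = "\<lambda>x. min 1 (h x)"
  have meas: "(\<lambda>t. ?l u t) \<in> borel_measurable borel"
    if [measurable]: "u \<in> borel_measurable borel" for u :: "real \<Rightarrow> ennreal"
    by measurable
  have "(\<integral>\<^sup>+x. f x \<partial>lborel) + (\<integral>\<^sup>+x. g x \<partial>lborel) = (\<integral>\<^sup>+t. ?l f t + ?l g t \<partial>lborel)"
    by (simp add: cake le1 meas nn_integral_add)
  also have "\<dots> \<le> (\<integral>\<^sup>+t. 2 * ?l ?h t \<partial>lborel)"
  proof (rule nn_integral_mono)
    fix t :: real
    show "?l f t + ?l g t \<le> 2 * ?l ?h t"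
    proof (cases "t \<in> {0..<1}")
      case True
      then have t: "ennreal t < 1" by (simp add: ennreal_less_one_iff)
      have "emeasure lborel {x. ennreal t < f x} + emeasure lborel {x. ennreal t < g x}
          \<le> 2 * emeasure lborel {x. ennreal t < ?h x}"
      proof (rule midpoint_set_measure)
        show "{x. ennreal t < f x} \<noteq> {}" "{x. ennreal t < g x} \<noteq> {}"
          using t sup less_SUP_iff[of "ennreal t" f UNIV] less_SUP_iff[of "ennreal t" g UNIV] by auto
        show "bounded {x. ennreal t < f x}" "bounded {x. ennreal t < g x}"
          by (rule bounded_subset[OF bd(1)] bounded_subset[OF bd(2)], force)+
        show "(a + b) / 2 \<in> {x. ennreal t < ?h x}"
          if "a \<in> {x. ennreal t < f x}" "b \<in> {x. ennreal t < g x}" for a b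
          using that t mid[of a b] level_set_midpoint[of "ennreal t" "f a" "g b"] by auto
      qed measurable
      then show ?thesis using True by simp
    qed simp
  qed
  also have "\<dots> = 2 * (\<integral>\<^sup>+x. ?h x \<partial>lborel)"
    by (subst cake) (simp_all add: meas nn_integral_cmult)
  also have "\<dots> \<le> 2 * (\<integral>\<^sup>+x. h x \<partial>lborel)"
    by (intro mult_left_mono nn_integral_mono) auto
  finally show ?thesis .
qed

lemma ennreal_arith_geo_mean:
  fixes a b c :: ennreal
  assumes "a + b \<le> 2 * c"
  shows "a * b \<le> c\<^sup>2"
proof (cases "c = top")
  case False
  then have fin: "a \<noteq> top" "b \<noteq> top"
    using assms by (auto simp: top_unique ennreal_mult_eq_top_iff)
  then obtain x y z where [simp]: "a = ennreal x" "b = ennreal y" "c = ennreal z"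
    and nn [simp]: "0 \<le> x" "0 \<le> y" "0 \<le> z"
    using False by (metis ennreal_cases)
  have "ennreal (x + y) \<le> ennreal (2 * z)"
    using assms by (simp add: ennreal_mult)
  then have "x + y \<le> 2 * z"
    by (subst (asm) ennreal_le_iff) simp_all
  then have "((x + y) / 2)\<^sup>2 \<le> z\<^sup>2"
    by (intro power_mono) auto
  moreover have "x * y \<le> ((x + y) / 2)\<^sup>2"
    using sum_squares_bound[of x y] by (simp add: power2_eq_square field_simps)
  ultimately have "x * y \<le> z\<^sup>2" by (rule order.trans[rotated])
  then show ?thesis
    by (simp add: ennreal_power ennreal_mult[symmetric] ennreal_leI)
qed simp

text \<open>Dividing \<open>f\<close> and \<open>g\<close> by their suprema \<open>p\<close> and \<open>q\<close> and \<open>h\<close> by the geometric mean of \<open>p\<close> and \<open>q\<close>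
  preserves the hypothesis; the inequality of arithmetic and geometric means turns the sum of the
  integrals into their product, where the factors cancel.\<close>
lemma prekopa_leindler_real_bounded:
  fixes f g h :: "real \<Rightarrow> ennreal"
  assumes [measurable]: "f \<in> borel_measurable borel" "g \<in> borel_measurable borel"
      "h \<in> borel_measurable borel"
    and fin: "(SUP x. f x) < top" "(SUP x. g x) < top"
    and bd: "bounded {x. f x \<noteq> 0}" "bounded {x. g x \<noteq> 0}"
    and mid: "\<And>x y. f x * g y \<le> (h ((x + y) / 2))\<^sup>2"
  shows "(\<integral>\<^sup>+x. f x \<partial>lborel) * (\<integral>\<^sup>+x. g x \<partial>lborel) \<le> (\<integral>\<^sup>+x. h x \<partial>lborel)\<^sup>2"
proof (cases "(SUP x. f x) = 0 \<or> (SUP x. g x) = 0")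
  case True
  then have "(\<forall>x. f x = 0) \<or> (\<forall>x. g x = 0)"
    by (auto simp: SUP_eq_iff bot_ennreal)
  then show ?thesis by auto
next
  case False
  obtain p where p: "(SUP x. f x) = ennreal p" "0 < p"
    using fin(1) False by (cases "SUP x. f x") (auto simp: order_le_less)
  obtain q where q: "(SUP x. g x) = ennreal q" "0 < q"
    using fin(2) False by (cases "SUP x. g x") (auto simp: order_le_less)
  define r where "r = sqrt (p * q)"
  have r: "0 < r" "r\<^sup>2 = p * q" using p q by (simp_all add: r_def)
  have sup: "(SUP x. ennreal (1 / p) * f x) = 1" "(SUP x. ennreal (1 / q) * g x) = 1"
    using p q by (simp_all add: SUP_mult_left_ennreal[symmetric] ennreal_mult[symmetric])
  have "ennreal (1 / p) * f x * (ennreal (1 / q) * g y) \<le> (ennreal (1 / r) * h ((x + y) / 2))\<^sup>2" for x y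
  proof -
    have "ennreal (1 / p) * f x * (ennreal (1 / q) * g y) = ennreal ((1 / r)\<^sup>2) * (f x * g y)"
      using p q r by (simp add: ac_simps power_divide ennreal_mult[symmetric] flip: mult.assoc)
    also have "\<dots> \<le> ennreal ((1 / r)\<^sup>2) * (h ((x + y) / 2))\<^sup>2"
      by (intro mult_left_mono mid) simp
    finally show ?thesis using r by (simp add: power_mult_distrib ennreal_power)
  qed
  moreover have "bounded {x. ennreal (1 / p) * f x \<noteq> 0}" "bounded {x. ennreal (1 / q) * g x \<noteq> 0}"
    by (rule bounded_subset[OF bd(1)] bounded_subset[OF bd(2)], force)+
  ultimately have "(\<integral>\<^sup>+x. ennreal (1 / p) * f x \<partial>lborel) + (\<integral>\<^sup>+x. ennreal (1 / q) * g x \<partial>lborel)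
      \<le> 2 * (\<integral>\<^sup>+x. ennreal (1 / r) * h x \<partial>lborel)"
    by (intro prekopa_leindler_normalized sup) measurable
  then have "(ennreal (1 / p) * (\<integral>\<^sup>+x. f x \<partial>lborel)) * (ennreal (1 / q) * (\<integral>\<^sup>+x. g x \<partial>lborel))
      \<le> (ennreal (1 / r) * (\<integral>\<^sup>+x. h x \<partial>lborel))\<^sup>2"
    by (intro ennreal_arith_geo_mean) (simp add: nn_integral_cmult)
  then have "ennreal (r\<^sup>2) * ((ennreal (1 / p) * (\<integral>\<^sup>+x. f x \<partial>lborel)) * (ennreal (1 / q) * (\<integral>\<^sup>+x. g x \<partial>lborel)))
      \<le> ennreal (r\<^sup>2) * (ennreal (1 / r) * (\<integral>\<^sup>+x. h x \<partial>lborel))\<^sup>2"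
    by (rule mult_left_mono) simp
  also have "\<dots> = ennreal (r\<^sup>2 * (1 / r)\<^sup>2) * (\<integral>\<^sup>+x. h x \<partial>lborel)\<^sup>2"
    using r(1) by (simp add: power_mult_distrib ennreal_power ennreal_mult mult.assoc)
  also have "ennreal (r\<^sup>2) * ((ennreal (1 / p) * (\<integral>\<^sup>+x. f x \<partial>lborel)) * (ennreal (1 / q) * (\<integral>\<^sup>+x. g x \<partial>lborel)))
      = ennreal (r\<^sup>2 * (1 / p) * (1 / q)) * ((\<integral>\<^sup>+x. f x \<partial>lborel) * (\<integral>\<^sup>+x. g x \<partial>lborel))"
  proof -
    have "0 \<le> 1 / p" "0 \<le> 1 / q" using p(2) q(2) by simp_all
    then have "ennreal (r\<^sup>2 * (1 / p) * (1 / q)) = ennreal (r\<^sup>2) * ennreal (1 / p) * ennreal (1 / q)"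
      by (simp only: ennreal_mult'')
    then show ?thesis by (simp only: ac_simps)
  qed
  finally show ?thesis
    using p q r by (simp add: power_divide)
qed

text \<open>Truncating \<open>f\<close> and \<open>g\<close> in height and support preserves the hypothesis, and monotone
  convergence removes the truncation.\<close>
lemma prekopa_leindler_real:
  fixes f g h :: "real \<Rightarrow> ennreal"
  assumes [measurable]: "f \<in> borel_measurable borel" "g \<in> borel_measurable borel"
      "h \<in> borel_measurable borel"
    and mid: "\<And>x y. f x * g y \<le> (h ((x + y) / 2))\<^sup>2"
  shows "(\<integral>\<^sup>+x. f x \<partial>lborel) * (\<integral>\<^sup>+x. g x \<partial>lborel) \<le> (\<integral>\<^sup>+x. h x \<partial>lborel)\<^sup>2"
proof -
  define cut where "cut u k x = min (of_nat k) (u x) * indicator {- real k..real k} x"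
    for u :: "real \<Rightarrow> ennreal" and k x
  have cut_le: "cut u k x \<le> u x" "cut u k x \<le> of_nat k" for u k x
    by (auto simp: cut_def indicator_def)
  have inc: "incseq (cut u)" for u
    by (auto simp: incseq_def le_fun_def cut_def indicator_def intro: min.coboundedI1)
  have sup: "(SUP k. cut u k x) = u x" for u x
  proof (rule antisym)
    show "(SUP k. cut u k x) \<le> u x" by (intro SUP_least cut_le)
    show "u x \<le> (SUP k. cut u k x)"
    proof (rule dense_le)
      fix y assume y: "y < u x"
      then obtain n where n: "y < of_nat n"
        by (metis ennreal_Ex_less_of_nat order.strict_trans2 top_greatest)
      obtain m where m: "\<bar>x\<bar> \<le> real m" using real_arch_simple by blast
      have "y \<le> cut u (max n m) x"
        using y n m by (auto simp: cut_def indicator_def abs_le_iff le_max_iff_disj intro: order.trans[OF less_imp_le])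
      then show "y \<le> (SUP k. cut u k x)" by (rule SUP_upper2[OF UNIV_I])
    qed
  qed
  have [measurable]: "cut u k \<in> borel_measurable borel" if [measurable]: "u \<in> borel_measurable borel" for u k
    unfolding cut_def by measurable
  have lim: "(\<integral>\<^sup>+x. u x \<partial>lborel) = (SUP k. \<integral>\<^sup>+x. cut u k x \<partial>lborel)"
    if [measurable]: "u \<in> borel_measurable borel" for u
    by (subst nn_integral_monotone_convergence_SUP[symmetric, OF inc]) (simp_all add: sup)
  have "(\<integral>\<^sup>+x. cut f j x \<partial>lborel) * (\<integral>\<^sup>+x. cut g k x \<partial>lborel) \<le> (\<integral>\<^sup>+x. h x \<partial>lborel)\<^sup>2" for j k
  proof (rule prekopa_leindler_real_bounded)
    show "(SUP x. cut f j x) < top" "(SUP x. cut g k x) < top"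
      by (rule le_less_trans[OF SUP_least[OF cut_le(2)]], simp add: of_nat_less_top)+
    show "bounded {x. cut f j x \<noteq> 0}" "bounded {x. cut g k x \<noteq> 0}"
      by (rule bounded_subset[OF bounded_closed_interval], force simp: cut_def indicator_def)+
    show "cut f j x * cut g k y \<le> (h ((x + y) / 2))\<^sup>2" for x y
      using mult_mono[OF cut_le(1)[of f j x] cut_le(1)[of g k y]] mid[of x y] by simp
  qed measurable
  then show ?thesis
    by (simp add: lim[OF assms(1)] lim[OF assms(2)] SUP_mult_left_ennreal SUP_mult_right_ennreal SUP_least)
qed

text \<open>Fubini reduces the dimension: for fixed remaining coordinates the one-dimensional inequality
  applies to the slices, and what it says is the hypothesis for the three functions obtained by
  integrating out one coordinate.\<close>
lemma prekopa_leindler_PiM: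
  fixes f g h :: "('i \<Rightarrow> real) \<Rightarrow> ennreal"
  assumes "finite I"
    and "f \<in> borel_measurable (\<Pi>\<^sub>M i\<in>I. lborel)" "g \<in> borel_measurable (\<Pi>\<^sub>M i\<in>I. lborel)"
      "h \<in> borel_measurable (\<Pi>\<^sub>M i\<in>I. lborel)"
    and "\<And>x y. x \<in> extensional I \<Longrightarrow> y \<in> extensional I \<Longrightarrow>
      f x * g y \<le> (h (\<lambda>i\<in>I. (x i + y i) / 2))\<^sup>2"
  shows "(\<integral>\<^sup>+x. f x \<partial>(\<Pi>\<^sub>M i\<in>I. lborel)) * (\<integral>\<^sup>+x. g x \<partial>(\<Pi>\<^sub>M i\<in>I. lborel))
    \<le> (\<integral>\<^sup>+x. h x \<partial>(\<Pi>\<^sub>M i\<in>I. lborel))\<^sup>2"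
  using assms
proof (induction I arbitrary: f g h rule: finite_induct)
  case empty
  interpret product_sigma_finite "\<lambda>_. lborel :: real measure" ..
  show ?case
    using empty(4)[of "\<lambda>_. undefined" "\<lambda>_. undefined"] by (simp add: nn_integral_empty restrict_def)
next
  case (insert j I)
  interpret product_sigma_finite "\<lambda>_. lborel :: real measure" ..
  note [measurable] = insert.prems(1-3)
  let ?P = "\<Pi>\<^sub>M i\<in>I. (lborel :: real measure)"
  let ?F = "\<lambda>u x. \<integral>\<^sup>+a. u (x(j := a)) \<partial>(lborel :: real measure)"
  have split: "(\<integral>\<^sup>+x. u x \<partial>(\<Pi>\<^sub>M i\<in>insert j I. lborel)) = (\<integral>\<^sup>+x. ?F u x \<partial>?P)"
    if "u \<in> borel_measurable (\<Pi>\<^sub>M i\<in>insert j I. lborel)" for u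
    using product_nn_integral_insert[OF insert.hyps that] .
  have meas: "?F u \<in> borel_measurable ?P"
    if [measurable]: "u \<in> borel_measurable (\<Pi>\<^sub>M i\<in>insert j I. lborel)" for u
    by measurable
  show ?case
    unfolding split[OF insert.prems(1)] split[OF insert.prems(2)] split[OF insert.prems(3)]
  proof (rule insert.IH)
    fix x y :: "'i \<Rightarrow> real" assume x: "x \<in> extensional I" and y: "y \<in> extensional I"
    let ?m = "\<lambda>i\<in>I. (x i + y i) / 2"
    have slice: "(\<lambda>a. u (z(j := a))) \<in> borel_measurable borel"
      if "u \<in> borel_measurable (\<Pi>\<^sub>M i\<in>insert j I. lborel)" "z \<in> extensional I" for u z
    proof -
      have [measurable]: "(\<lambda>a. z(j := a)) \<in> borel \<rightarrow>\<^sub>M (\<Pi>\<^sub>M i\<in>insert j I. lborel)"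
        using that(2) by (intro measurable_PiM_single') (auto simp: extensional_def PiE_def)
      show ?thesis using that(1) by measurable
    qed
    show "?F f x * ?F g y \<le> (?F h ?m)\<^sup>2"
    proof (rule prekopa_leindler_real)
      fix a b :: real
      have "(\<lambda>i\<in>insert j I. ((x(j := a)) i + (y(j := b)) i) / 2) = ?m(j := (a + b) / 2)"
        using insert.hyps by (auto simp: fun_eq_iff)
      moreover have "x(j := a) \<in> extensional (insert j I)" "y(j := b) \<in> extensional (insert j I)"
        using x y by (auto simp: extensional_def)
      ultimately show "f (x(j := a)) * g (y(j := b)) \<le> (h (?m(j := (a + b) / 2)))\<^sup>2"
        using insert.prems(4)[of "x(j := a)" "y(j := b)"] by metis
    qed (use x y insert.prems in \<open>auto intro!: slice\<close>)
  qed (intro meas insert.prems)+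
qed

text \<open>Coordinates with respect to \<open>Basis\<close> turn \<open>lborel\<close> into a product of Lebesgue measures on the
  line and midpoints into coordinatewise midpoints.\<close>
theorem prekopa_leindler:
  fixes f g h :: "'a::euclidean_space \<Rightarrow> ennreal"
  assumes [measurable]: "f \<in> borel_measurable borel" "g \<in> borel_measurable borel"
      "h \<in> borel_measurable borel"
    and mid: "\<And>x y. f x * g y \<le> (h ((1 / 2) *\<^sub>R (x + y)))\<^sup>2"
  shows "(\<integral>\<^sup>+x. f x \<partial>lborel) * (\<integral>\<^sup>+x. g x \<partial>lborel) \<le> (\<integral>\<^sup>+x. h x \<partial>lborel)\<^sup>2"
proof -
  let ?P = "\<Pi>\<^sub>M b\<in>(Basis :: 'a set). (lborel :: real measure)"
  let ?v = "\<lambda>x. \<Sum>b\<in>Basis. x b *\<^sub>R (b :: 'a)"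
  have [measurable]: "?v \<in> ?P \<rightarrow>\<^sub>M borel" by measurable
  have coord: "(\<integral>\<^sup>+x. u x \<partial>lborel) = (\<integral>\<^sup>+x. u (?v x) \<partial>?P)"
    if [measurable]: "u \<in> borel_measurable borel" for u :: "'a \<Rightarrow> ennreal"
    by (subst lborel_eq) (simp add: nn_integral_distr)
  have "?v (\<lambda>b\<in>Basis. (x b + y b) / 2) = (1 / 2) *\<^sub>R (?v x + ?v y)" for x y
    by (simp add: scaleR_sum_right sum.distrib[symmetric] scaleR_add_left[symmetric] add_divide_distrib)
  then show ?thesis
    using mid by (simp add: coord) (rule prekopa_leindler_PiM, simp_all)
qed

section \<open>Two facts from calculus\<close>

text \<open>Otherwise \<open>\<phi>'\<close> would be larger to the right of \<open>a\<close> than to the left, and the symmetric sum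
  \<open>\<phi> (a + s) + \<phi> (a - s)\<close> would increase with \<open>s\<close>.\<close>
lemma midpoint_concave_imp_second_derivative_nonpos:
  fixes \<phi> \<phi>' :: "real \<Rightarrow> real"
  assumes d: "0 < d"
    and der: "\<And>t. \<bar>t - a\<bar> < d \<Longrightarrow> (\<phi> has_real_derivative \<phi>' t) (at t)"
    and der2: "(\<phi>' has_real_derivative l) (at a)"
    and mid: "\<And>s. 0 < s \<Longrightarrow> s < d \<Longrightarrow> \<phi> (a + s) + \<phi> (a - s) \<le> 2 * \<phi> a"
  shows "l \<le> 0"
proof (rule ccontr)
  assume "\<not> l \<le> 0"
  then have l: "0 < l" by simp
  obtain d1 where d1: "0 < d1" "\<And>h. 0 < h \<Longrightarrow> h < d1 \<Longrightarrow> \<phi>' a < \<phi>' (a + h)"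
    using DERIV_pos_inc_right[OF der2 l] by auto
  obtain d2 where d2: "0 < d2" "\<And>h. 0 < h \<Longrightarrow> h < d2 \<Longrightarrow> \<phi>' (a - h) < \<phi>' a"
    using DERIV_pos_inc_left[OF der2 l] by auto
  define e where "e = min d (min d1 d2) / 2"
  have e: "0 < e" "e < d" "e < d1" "e < d2" using d d1(1) d2(1) by (auto simp: e_def)
  let ?\<psi> = "\<lambda>s. \<phi> (a + s) + \<phi> (a - s)"
  have der_\<psi>: "(?\<psi> has_real_derivative \<phi>' (a + s) - \<phi>' (a - s)) (at s)" if "0 \<le> s" "s \<le> e" for s
  proof -
    have "((\<lambda>s. \<phi> (a + s)) has_real_derivative \<phi>' (a + s) * 1) (at s)"
      by (rule DERIV_chain2[OF der]) (use that e in \<open>auto intro!: derivative_eq_intros\<close>)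
    moreover have "((\<lambda>s. \<phi> (a - s)) has_real_derivative \<phi>' (a - s) * - 1) (at s)"
      by (rule DERIV_chain2[OF der]) (use that e in \<open>auto intro!: derivative_eq_intros\<close>)
    ultimately show ?thesis
      using DERIV_add by fastforce
  qed
  have "?\<psi> 0 < ?\<psi> e"
  proof (rule DERIV_pos_imp_increasing_open[OF e(1)])
    show "\<exists>y. DERIV ?\<psi> s :> y \<and> 0 < y" if "0 < s" "s < e" for s
      using der_\<psi>[of s] d1(2)[of s] d2(2)[of s] that e by (intro exI[of _ "\<phi>' (a + s) - \<phi>' (a - s)"]) auto
    show "continuous_on {0..e} ?\<psi>"
      using der_\<psi> by (intro continuous_at_imp_continuous_on ballI) (meson DERIV_isCont atLeastAtMost_iff)
  qed
  with mid[of e] e show False by simp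
qed

lemma exp_minus_affine_bound:
  fixes b :: real
  shows "\<bar>exp b - 1 - b\<bar> \<le> b\<^sup>2 * exp \<bar>b\<bar>"
proof -
  obtain t where t: "\<bar>t\<bar> \<le> \<bar>b\<bar>" "exp b = (\<Sum>m<2. b ^ m / fact m) + exp t / fact 2 * b ^ 2"
    using Maclaurin_exp_le[of b 2] by blast
  then have eq: "exp b - 1 - b = b\<^sup>2 * (exp t / 2)" by (simp add: numeral_2_eq_2)
  have "exp t / 2 \<le> exp \<bar>b\<bar>"
    using t(1) exp_le_cancel_iff[of t "\<bar>b\<bar>"] exp_gt_zero[of t] by linarith
  then have "b\<^sup>2 * (exp t / 2) \<le> b\<^sup>2 * exp \<bar>b\<bar>" by (rule mult_left_mono) simp
  then show ?thesis unfolding eq by (simp add: abs_mult)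
qed

section \<open>Exponential integrals over a compact body\<close>

locale compact_body =
  fixes K :: "'a::euclidean_space set"
  assumes compact: "compact K" and interior_nonempty: "interior K \<noteq> {}"
begin

text \<open>Up to the factor \<open>partition_function\<close>, the expectation of \<open>u\<close> under the probability density on
  \<open>K\<close> proportional to \<open>exp (\<theta> \<bullet> x)\<close>. Allowing vector values covers the partition function
  and the first moment by a single differentiation rule.\<close>
definition tilted_integral :: "('a \<Rightarrow> 'b::euclidean_space) \<Rightarrow> 'a \<Rightarrow> 'b" where
  "tilted_integral u \<theta> = (LINT x:K|lborel. exp (\<theta> \<bullet> x) *\<^sub>R u x)"

lemma tilted_integral_integrable:
  "continuous_on K u \<Longrightarrow> set_integrable lborel K (\<lambda>x. exp (\<theta> \<bullet> x) *\<^sub>R (u x :: 'b::euclidean_space))"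
  unfolding set_integrable_def by (intro borel_integrable_compact compact continuous_intros)

lemma tilted_integral_bounded_linear:
  assumes "bounded_linear P" "continuous_on K u"
  shows "tilted_integral (\<lambda>x. P (u x)) \<theta> = P (tilted_integral u \<theta>)"
  using integral_bounded_linear[OF assms(1) tilted_integral_integrable[OF assms(2), unfolded set_integrable_def], of \<theta>]
  by (simp add: tilted_integral_def set_lebesgue_integral_def linear_simps(5)[OF assms(1)])

lemma tilted_integral_add:
  "continuous_on K u \<Longrightarrow> continuous_on K v \<Longrightarrow> tilted_integral (\<lambda>x. u x + v x) \<theta> = tilted_integral u \<theta> + tilted_integral v \<theta>"
  using set_integral_add(2)[OF tilted_integral_integrable tilted_integral_integrable, of u v \<theta> \<theta>]
  by (simp add: tilted_integral_def scaleR_add_right)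

lemma tilted_integral_diff:
  "continuous_on K u \<Longrightarrow> continuous_on K v \<Longrightarrow> tilted_integral (\<lambda>x. u x - v x) \<theta> = tilted_integral u \<theta> - tilted_integral v \<theta>"
  using set_integral_diff(2)[OF tilted_integral_integrable tilted_integral_integrable, of u v \<theta> \<theta>]
  by (simp add: tilted_integral_def scaleR_diff_right)

lemma tilted_integral_mult_left:
  "continuous_on K u \<Longrightarrow> tilted_integral (\<lambda>x. c * u x) \<theta> = c * (tilted_integral u \<theta> :: real)"
  using tilted_integral_bounded_linear[OF bounded_linear_mult_right] .

lemma tilted_integral_scaleR_left:
  "continuous_on K u \<Longrightarrow> tilted_integral (\<lambda>x. c *\<^sub>R u x) \<theta> = c *\<^sub>R tilted_integral u \<theta>"
  using tilted_integral_bounded_linear[OF bounded_linear_scaleR_right] .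

lemma tilted_integral_scaleR_right:
  "continuous_on K u \<Longrightarrow> tilted_integral (\<lambda>x. u x *\<^sub>R c) \<theta> = tilted_integral u \<theta> *\<^sub>R c"
  using tilted_integral_bounded_linear[OF bounded_linear_scaleR_left] .

lemma tilted_integral_inner:
  "continuous_on K u \<Longrightarrow> tilted_integral (\<lambda>x. c \<bullet> u x) \<theta> = c \<bullet> tilted_integral u \<theta>"
  using tilted_integral_bounded_linear[OF bounded_linear_inner_right] .

text \<open>A nonnegative function with vanishing integral vanishes almost everywhere, so it cannot
  be positive on the nonempty open set of interior points near \<open>x\<close>.\<close>
lemma tilted_integral_pos:
  fixes v :: "'a \<Rightarrow> real"
  assumes cont: "continuous_on K v" and nonneg: "\<And>x. x \<in> K \<Longrightarrow> 0 \<le> v x"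
    and x: "x \<in> interior K" "0 < v x"
  shows "0 < tilted_integral v \<theta>"
proof -
  let ?w = "\<lambda>x. indicator K x *\<^sub>R exp (\<theta> \<bullet> x) *\<^sub>R v x"
  have int: "integrable lborel ?w"
    using tilted_integral_integrable[OF cont] by (simp add: set_integrable_def)
  have nn: "0 \<le> ?w x" for x using nonneg by (auto simp: indicator_def)
  have "tilted_integral v \<theta> \<noteq> 0"
  proof
    assume "tilted_integral v \<theta> = 0"
    then have "AE x in lborel. ?w x = 0"
      using integral_nonneg_eq_0_iff_AE[OF int] nn by (simp add: tilted_integral_def set_lebesgue_integral_def)
    then have "AE x in lebesgue. ?w x = 0"
      by (rule AE_completion)
    moreover
    define U where "U = interior K \<inter> v -` {0<..}"
    have "open U" unfolding U_def
      by (rule continuous_open_preimage) (use cont interior_subset in \<open>auto intro: continuous_on_subset\<close>)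
    have "x \<in> U" using x by (simp add: U_def)
    have "?w y \<noteq> 0" if "y \<in> U" for y
      using that interior_subset[of K] by (auto simp: U_def)
    ultimately have "AE y in lebesgue. y \<notin> U" by (auto elim!: eventually_mono)
    then have "negligible U"
      using \<open>open U\<close> by (simp add: negligible_iff_null_sets AE_iff_null_sets)
    with \<open>open U\<close> \<open>x \<in> U\<close> show False using open_not_negligible by blast
  qed
  moreover have "0 \<le> tilted_integral v \<theta>"
    unfolding tilted_integral_def set_lebesgue_integral_def by (rule Bochner_Integration.integral_nonneg) (use nn in simp)
  ultimately show ?thesis by simp
qed

text \<open>Differentiation under the integral sign. Since \<open>K\<close> is bounded, the second-order Taylor remainder
  of the exponential is at most a constant times the square of the increment, uniformly on \<open>K\<close>.\<close>
lemma has_derivative_tilted_integral: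
  fixes u :: "'a \<Rightarrow> 'b::euclidean_space"
  assumes cont: "continuous_on K u"
  shows "(tilted_integral u has_derivative (\<lambda>h. tilted_integral (\<lambda>x. (h \<bullet> x) *\<^sub>R u x) \<theta>)) (at \<theta>)"
proof -
  obtain B where B: "0 < B" "\<And>x. x \<in> K \<Longrightarrow> norm x \<le> B"
    using compact_imp_bounded[OF compact] by (auto simp: bounded_pos)
  define C where "C = (B\<^sup>2 * exp B) * tilted_integral (\<lambda>x. norm (u x)) \<theta>"
  have cont': "continuous_on K (\<lambda>x. (h \<bullet> x) *\<^sub>R u x)" for h
    by (intro continuous_intros cont)
  have lin: "linear (\<lambda>h. tilted_integral (\<lambda>x. (h \<bullet> x) *\<^sub>R u x) \<theta>)"
  proof (rule linearI)
    show "tilted_integral (\<lambda>x. ((g + h) \<bullet> x) *\<^sub>R u x) \<theta>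
        = tilted_integral (\<lambda>x. (g \<bullet> x) *\<^sub>R u x) \<theta> + tilted_integral (\<lambda>x. (h \<bullet> x) *\<^sub>R u x) \<theta>" for g h
      using tilted_integral_add[OF cont' cont', of g h \<theta>] by (simp add: inner_add_left scaleR_add_left)
    show "tilted_integral (\<lambda>x. ((c *\<^sub>R h) \<bullet> x) *\<^sub>R u x) \<theta> = c *\<^sub>R tilted_integral (\<lambda>x. (h \<bullet> x) *\<^sub>R u x) \<theta>" for c h
      using tilted_integral_scaleR_left[OF cont', of c h \<theta>] by simp
  qed
  have bound: "norm (tilted_integral u \<eta> - tilted_integral u \<theta> - tilted_integral (\<lambda>x. ((\<eta> - \<theta>) \<bullet> x) *\<^sub>R u x) \<theta>)
      \<le> C * (norm (\<eta> - \<theta>))\<^sup>2" if small: "norm (\<eta> - \<theta>) < 1" for \<eta>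
  proof -
    define h where "h = \<eta> - \<theta>"
    have shift: "tilted_integral u \<eta> = tilted_integral (\<lambda>x. exp (h \<bullet> x) *\<^sub>R u x) \<theta>"
      by (simp add: tilted_integral_def h_def inner_diff_left flip: exp_add)
    have "tilted_integral u \<eta> - tilted_integral u \<theta> - tilted_integral (\<lambda>x. (h \<bullet> x) *\<^sub>R u x) \<theta>
        = tilted_integral (\<lambda>x. (exp (h \<bullet> x) - 1 - h \<bullet> x) *\<^sub>R u x) \<theta>"
      unfolding shift
      by (subst tilted_integral_diff[symmetric], (intro continuous_intros cont)+)+ (simp add: scaleR_diff_left)
    also have "norm \<dots> \<le> tilted_integral (\<lambda>x. (B\<^sup>2 * exp B * (norm h)\<^sup>2) * norm (u x)) \<theta>"
      unfolding tilted_integral_def set_lebesgue_integral_def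
    proof (rule Bochner_Integration.integral_norm_bound_integral)
      show "integrable lborel (\<lambda>x. indicator K x *\<^sub>R exp (\<theta> \<bullet> x) *\<^sub>R (exp (h \<bullet> x) - 1 - h \<bullet> x) *\<^sub>R u x)"
        by (intro borel_integrable_compact compact continuous_intros cont)
      show "integrable lborel (\<lambda>x. indicator K x *\<^sub>R exp (\<theta> \<bullet> x) *\<^sub>R (B\<^sup>2 * exp B * (norm h)\<^sup>2 * norm (u x)))"
        by (intro borel_integrable_compact compact continuous_intros cont)
      fix x
      have "\<bar>exp (h \<bullet> x) - 1 - h \<bullet> x\<bar> \<le> B\<^sup>2 * exp B * (norm h)\<^sup>2" if "x \<in> K"
      proof -
        have hx: "\<bar>h \<bullet> x\<bar> \<le> norm h * B"
          using Cauchy_Schwarz_ineq2[of h x] B(2)[OF that] mult_left_mono[of "norm x" B "norm h"] by auto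
        also have "\<dots> \<le> B" using small B(1) by (simp add: h_def mult_le_cancel_right1)
        finally have "exp \<bar>h \<bullet> x\<bar> \<le> exp B" by simp
        moreover have "(h \<bullet> x)\<^sup>2 \<le> (norm h * B)\<^sup>2" using power_mono[OF hx, of 2] by simp
        ultimately have "(h \<bullet> x)\<^sup>2 * exp \<bar>h \<bullet> x\<bar> \<le> (norm h * B)\<^sup>2 * exp B" by (intro mult_mono) auto
        then show ?thesis
          using exp_minus_affine_bound[of "h \<bullet> x"] by (simp add: power_mult_distrib mult_ac)
      qed
      then show "norm (indicator K x *\<^sub>R exp (\<theta> \<bullet> x) *\<^sub>R (exp (h \<bullet> x) - 1 - h \<bullet> x) *\<^sub>R u x)
          \<le> indicator K x *\<^sub>R exp (\<theta> \<bullet> x) *\<^sub>R (B\<^sup>2 * exp B * (norm h)\<^sup>2 * norm (u x))"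
        by (auto simp: indicator_def abs_mult mult.assoc[symmetric] mult_left_mono intro!: mult_right_mono)
    qed
    also have "\<dots> = C * (norm h)\<^sup>2"
      by (subst tilted_integral_mult_left) (auto intro!: continuous_intros cont simp: C_def)
    finally show ?thesis by (simp add: h_def)
  qed
  show ?thesis
  proof (rule has_derivativeI_sandwich[of 1])
    show "bounded_linear (\<lambda>h. tilted_integral (\<lambda>x. (h \<bullet> x) *\<^sub>R u x) \<theta>)"
      using lin by (simp add: linear_conv_bounded_linear)
    show "norm (tilted_integral u \<eta> - tilted_integral u \<theta> - tilted_integral (\<lambda>x. ((\<eta> - \<theta>) \<bullet> x) *\<^sub>R u x) \<theta>) / norm (\<eta> - \<theta>)
        \<le> C * norm (\<eta> - \<theta>)" if "\<eta> \<noteq> \<theta>" "dist \<eta> \<theta> < 1" for \<eta>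
      using bound[of \<eta>] that by (simp add: dist_norm divide_simps power2_eq_square mult_ac)
    show "((\<lambda>\<eta>. C * norm (\<eta> - \<theta>)) \<longlongrightarrow> 0) (at \<theta>)"
      by (rule tendsto_eq_intros refl | simp)+
  qed simp
qed

section \<open>Mean and covariance of the tilted density\<close>

text \<open>The log-Laplace transform is \<open>ln partition_function\<close>; its gradient and Hessian are the mean and
  the covariance of the tilted density. The covariance is kept as a linear map because it is used
  as the derivative of the mean and has to be inverted.\<close>
definition partition_function :: "'a \<Rightarrow> real" where
  "partition_function = tilted_integral (\<lambda>_. 1)"

definition mean :: "'a \<Rightarrow> 'a" where
  "mean \<theta> = tilted_integral (\<lambda>x. x) \<theta> /\<^sub>R partition_function \<theta>"

definition covariance :: "'a \<Rightarrow> 'a \<Rightarrow> 'a" where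
  "covariance \<theta> h = tilted_integral (\<lambda>x. (h \<bullet> (x - mean \<theta>)) *\<^sub>R (x - mean \<theta>)) \<theta> /\<^sub>R partition_function \<theta>"

lemma partition_function_pos: "0 < partition_function \<theta>"
  using interior_nonempty tilted_integral_pos[of "\<lambda>_. 1"] by (auto simp: partition_function_def)

lemma tilted_integral_id: "tilted_integral (\<lambda>x. x) \<theta> = partition_function \<theta> *\<^sub>R mean \<theta>"
  using partition_function_pos[of \<theta>] by (simp add: mean_def)

lemma tilted_integral_const: "tilted_integral (\<lambda>x. c) \<theta> = partition_function \<theta> *\<^sub>R c"
  using tilted_integral_scaleR_right[of "\<lambda>_. 1" c \<theta>] by (simp add: partition_function_def)

lemma has_derivative_partition_function:
  "(partition_function has_derivative (\<lambda>h. partition_function \<theta> * (h \<bullet> mean \<theta>))) (at \<theta>)"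
  using has_derivative_tilted_integral[of "\<lambda>_. 1 :: real" \<theta>]
  by (simp add: partition_function_def[symmetric] tilted_integral_inner tilted_integral_id)

lemma has_derivative_ln_partition_function:
  "((\<lambda>\<theta>. ln (partition_function \<theta>)) has_derivative (\<lambda>h. h \<bullet> mean \<theta>)) (at \<theta>)"
  using partition_function_pos[of \<theta>]
  by (auto intro!: derivative_eq_intros has_derivative_partition_function)

lemma covariance_alt:
  "covariance \<theta> h = tilted_integral (\<lambda>x. (h \<bullet> x) *\<^sub>R x) \<theta> /\<^sub>R partition_function \<theta> - (h \<bullet> mean \<theta>) *\<^sub>R mean \<theta>"
proof -
  let ?m = "mean \<theta>"
  have cont: "continuous_on K (\<lambda>x. (h \<bullet> x) *\<^sub>R x)" "continuous_on K (\<lambda>x. (h \<bullet> x) *\<^sub>R c)"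
    "continuous_on K (\<lambda>x. a *\<^sub>R x)" "continuous_on K (\<lambda>x. c)" for a and c :: 'a
    by (auto intro!: continuous_intros)
  have "tilted_integral (\<lambda>x. (h \<bullet> (x - ?m)) *\<^sub>R (x - ?m)) \<theta>
      = tilted_integral (\<lambda>x. (h \<bullet> x) *\<^sub>R x - (h \<bullet> x) *\<^sub>R ?m - (h \<bullet> ?m) *\<^sub>R x + (h \<bullet> ?m) *\<^sub>R ?m) \<theta>"
    by (simp add: algebra_simps)
  also have "\<dots> = tilted_integral (\<lambda>x. (h \<bullet> x) *\<^sub>R x) \<theta> - tilted_integral (\<lambda>x. (h \<bullet> x) *\<^sub>R ?m) \<theta>
      - tilted_integral (\<lambda>x. (h \<bullet> ?m) *\<^sub>R x) \<theta> + tilted_integral (\<lambda>x. (h \<bullet> ?m) *\<^sub>R ?m) \<theta>"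
    by (simp add: tilted_integral_add tilted_integral_diff cont continuous_on_diff)
  also have "\<dots> = tilted_integral (\<lambda>x. (h \<bullet> x) *\<^sub>R x) \<theta> - partition_function \<theta> *\<^sub>R (h \<bullet> ?m) *\<^sub>R ?m"
    by (simp add: tilted_integral_scaleR_right tilted_integral_scaleR_left tilted_integral_inner tilted_integral_id tilted_integral_const
        continuous_on_inner)
  finally show ?thesis
    using partition_function_pos[of \<theta>] by (simp add: covariance_def scaleR_diff_right)
qed

lemma has_derivative_mean: "(mean has_derivative covariance \<theta>) (at \<theta>)"
proof -
  let ?Z = "partition_function"
  have "((\<lambda>\<eta>. inverse (?Z \<eta>) *\<^sub>R tilted_integral (\<lambda>x. x) \<eta>) has_derivative
      (\<lambda>h. inverse (?Z \<theta>) *\<^sub>R tilted_integral (\<lambda>x. (h \<bullet> x) *\<^sub>R x) \<theta>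
        + (- (inverse (?Z \<theta>) * (?Z \<theta> * (h \<bullet> mean \<theta>)) * inverse (?Z \<theta>))) *\<^sub>R tilted_integral (\<lambda>x. x) \<theta>)) (at \<theta>)"
  proof (rule has_derivative_scaleR)
    show "((\<lambda>\<eta>. inverse (?Z \<eta>)) has_derivative
        (\<lambda>h. - (inverse (?Z \<theta>) * (?Z \<theta> * (h \<bullet> mean \<theta>)) * inverse (?Z \<theta>)))) (at \<theta>)"
      using partition_function_pos[of \<theta>]
      by (intro Deriv.has_derivative_inverse has_derivative_partition_function) simp
  qed (intro has_derivative_tilted_integral continuous_on_id)
  also have "(\<lambda>h. inverse (?Z \<theta>) *\<^sub>R tilted_integral (\<lambda>x. (h \<bullet> x) *\<^sub>R x) \<theta>
        + (- (inverse (?Z \<theta>) * (?Z \<theta> * (h \<bullet> mean \<theta>)) * inverse (?Z \<theta>))) *\<^sub>R tilted_integral (\<lambda>x. x) \<theta>)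
      = covariance \<theta>"
    using partition_function_pos[of \<theta>] by (simp add: covariance_alt tilted_integral_id fun_eq_iff)
  finally show ?thesis by (simp add: mean_def[abs_def])
qed

lemma linear_covariance: "linear (covariance \<theta>)"
  using has_derivative_mean has_derivative_linear by blast

lemma inner_covariance:
  "k \<bullet> covariance \<theta> h = tilted_integral (\<lambda>x. (h \<bullet> (x - mean \<theta>)) * (k \<bullet> (x - mean \<theta>))) \<theta> / partition_function \<theta>"
proof -
  have "continuous_on K (\<lambda>x. (h \<bullet> (x - mean \<theta>)) *\<^sub>R (x - mean \<theta>))"
    by (intro continuous_intros)
  from tilted_integral_inner[OF this, of k \<theta>] show ?thesis
    by (simp add: covariance_def divide_inverse mult.commute)
qed

lemma covariance_symmetric: "k \<bullet> covariance \<theta> h = h \<bullet> covariance \<theta> k"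
  by (simp add: inner_covariance mult.commute)

lemma covariance_pos:
  assumes "h \<noteq> 0"
  shows "0 < h \<bullet> covariance \<theta> h"
proof -
  obtain x where x: "x \<in> interior K" "h \<bullet> (x - mean \<theta>) \<noteq> 0"
  proof -
    obtain x e where e: "0 < e" "ball x e \<subseteq> interior K"
      using interior_nonempty open_interior[of K] by (meson ex_in_conv open_contains_ball)
    let ?y = "x + (e / (2 * norm h)) *\<^sub>R h"
    have "?y \<in> interior K" "x \<in> interior K" using e assms by (auto simp: dist_norm intro!: subsetD[OF e(2)])
    moreover have "h \<bullet> (?y - mean \<theta>) \<noteq> h \<bullet> (x - mean \<theta>)"
      using e(1) assms by (simp add: inner_diff_right inner_add_right)
    ultimately show ?thesis using that by metis
  qed
  then have "0 < tilted_integral (\<lambda>x. (h \<bullet> (x - mean \<theta>)) * (h \<bullet> (x - mean \<theta>))) \<theta>"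
    by (intro tilted_integral_pos[of _ x] continuous_intros) (auto simp: zero_less_mult_iff)
  then show ?thesis
    using partition_function_pos[of \<theta>] by (simp add: inner_covariance)
qed

text \<open>Along the segment from \<open>a\<close> to \<open>b\<close> the component of the mean in the direction of the segment is
  strictly increasing, because the covariance is positive definite.\<close>
lemma inj_mean: "inj mean"
proof (rule injI, rule ccontr)
  fix a b assume eq: "mean a = mean b" and ne: "a \<noteq> b"
  define h where "h = b - a"
  let ?\<psi> = "\<lambda>t. h \<bullet> mean (a + t *\<^sub>R h)"
  have "(?\<psi> has_real_derivative h \<bullet> covariance (a + t *\<^sub>R h) h) (at t)" for t
  proof -
    have "((\<lambda>t. a + t *\<^sub>R h) has_derivative (\<lambda>s. s *\<^sub>R h)) (at t)"
      by (auto intro!: derivative_eq_intros)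
    from has_derivative_compose[OF this has_derivative_mean]
    have "(?\<psi> has_derivative (\<lambda>s. h \<bullet> covariance (a + t *\<^sub>R h) (s *\<^sub>R h))) (at t)"
      by (rule has_derivative_inner_right)
    then show ?thesis
      by (simp add: has_field_derivative_def linear_cmul[OF linear_covariance] mult_commute_abs)
  qed
  moreover have "0 < h \<bullet> covariance (a + t *\<^sub>R h) h" for t
    using ne by (intro covariance_pos) (simp add: h_def)
  ultimately have "?\<psi> 0 < ?\<psi> 1"
    by (intro DERIV_pos_imp_increasing[OF zero_less_one]) blast
  then show False using eq by (simp add: h_def)
qed

text \<open>The variance of \<open>k - (b / a) h\<close> is nonnegative, where \<open>a\<close> is the variance in the direction \<open>h\<close>
  and \<open>b\<close> the covariance of the directions \<open>k\<close> and \<open>h\<close>.\<close>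
lemma covariance_Cauchy_Schwarz:
  "(k \<bullet> covariance \<theta> h)\<^sup>2 \<le> (k \<bullet> covariance \<theta> k) * (h \<bullet> covariance \<theta> h)"
proof (cases "h = 0")
  case True
  then show ?thesis by (simp add: linear_0[OF linear_covariance])
next
  case False
  let ?a = "h \<bullet> covariance \<theta> h" and ?b = "k \<bullet> covariance \<theta> h"
  have a: "0 < ?a" using covariance_pos[OF False] .
  let ?v = "k - (?b / ?a) *\<^sub>R h"
  have "0 \<le> ?v \<bullet> covariance \<theta> ?v"
    using covariance_pos[of ?v \<theta>] by (cases "?v = 0") auto
  also have "?v \<bullet> covariance \<theta> ?v = k \<bullet> covariance \<theta> k - ?b\<^sup>2 / ?a"
    using a covariance_symmetric[of h \<theta> k]
    by (simp add: linear_diff[OF linear_covariance] linear_cmul[OF linear_covariance]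
        inner_diff_left inner_diff_right power2_eq_square field_simps)
  finally show ?thesis using a by (simp add: field_simps)
qed

section \<open>The variance in the direction of the tilt\<close>

text \<open>Dilating the body scales the volume by \<open>t ^ DIM\<close> and the tilt by \<open>t\<close>. This factor is where the
  dimension in the final bound comes from.\<close>
lemma nn_integral_dilate:
  assumes t: "0 < t"
  shows "(\<integral>\<^sup>+y. indicator ((*\<^sub>R) t ` K) y * ennreal (exp (\<theta> \<bullet> y)) \<partial>lborel)
    = ennreal (t ^ DIM('a) * partition_function (t *\<^sub>R \<theta>))"
proof -
  have [measurable]: "(*\<^sub>R) t ` K \<in> sets borel"
    using compact_scaling[OF compact] by (simp add: borel_compact)
  have [measurable]: "K \<in> sets borel" using compact by (simp add: borel_compact)
  have "(\<integral>\<^sup>+y. indicator ((*\<^sub>R) t ` K) y * ennreal (exp (\<theta> \<bullet> y)) \<partial>lborel)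
      = (\<integral>\<^sup>+x. ennreal (t ^ DIM('a)) * (indicator ((*\<^sub>R) t ` K) (t *\<^sub>R x) * ennreal (exp (\<theta> \<bullet> (t *\<^sub>R x)))) \<partial>lborel)"
    by (subst lborel_affine[of t 0]) (use t in \<open>simp_all add: nn_integral_density nn_integral_distr\<close>)
  also have "\<dots> = ennreal (t ^ DIM('a)) * (\<integral>\<^sup>+x. ennreal (indicator K x * exp ((t *\<^sub>R \<theta>) \<bullet> x)) \<partial>lborel)"
    using t by (subst nn_integral_cmult[symmetric])
      (auto intro!: nn_integral_cong simp: indicator_def image_iff)
  also have "(\<integral>\<^sup>+x. ennreal (indicator K x * exp ((t *\<^sub>R \<theta>) \<bullet> x)) \<partial>lborel) = ennreal (partition_function (t *\<^sub>R \<theta>))"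
    using tilted_integral_integrable[of "\<lambda>_. 1 :: real" "t *\<^sub>R \<theta>"]
    by (subst nn_integral_eq_integral)
       (simp_all add: set_integrable_def partition_function_def tilted_integral_def set_lebesgue_integral_def)
  finally show ?thesis
    using t partition_function_pos[of "t *\<^sub>R \<theta>"] by (simp add: ennreal_mult)
qed

text \<open>Prekopa--Leindler for the functions \<open>exp (\<theta> \<bullet> y)\<close> cut off outside the dilates \<open>s K\<close>, \<open>t K\<close> and
  \<open>((s + t) / 2) K\<close>: the exponential is multiplicative, and by convexity midpoints of points of
  \<open>s K\<close> and \<open>t K\<close> lie in the intermediate dilate.\<close>
lemma dilated_partition_function_log_concave:
  fixes \<theta> :: 'a
  assumes conv: "convex K" and s: "0 < s" and t: "0 < t"
  defines "F \<equiv> \<lambda>t. t ^ DIM('a) * partition_function (t *\<^sub>R \<theta>)"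
  shows "F s * F t \<le> (F ((s + t) / 2))\<^sup>2"
proof -
  let ?f = "\<lambda>t y. indicator ((*\<^sub>R) t ` K) y * ennreal (exp (\<theta> \<bullet> y))"
  have [measurable]: "(*\<^sub>R) t ` K \<in> sets borel" for t :: real
    using compact_scaling[OF compact] by (simp add: borel_compact)
  have "(\<integral>\<^sup>+y. ?f s y \<partial>lborel) * (\<integral>\<^sup>+y. ?f t y \<partial>lborel) \<le> (\<integral>\<^sup>+y. ?f ((s + t) / 2) y \<partial>lborel)\<^sup>2"
  proof (rule prekopa_leindler)
    fix x y
    show "?f s x * ?f t y \<le> (?f ((s + t) / 2) ((1 / 2) *\<^sub>R (x + y)))\<^sup>2"
    proof (cases "x \<in> (*\<^sub>R) s ` K \<and> y \<in> (*\<^sub>R) t ` K")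
      case True
      then obtain a b where ab: "a \<in> K" "x = s *\<^sub>R a" "b \<in> K" "y = t *\<^sub>R b" by auto
      let ?c = "(s / (s + t)) *\<^sub>R a + (t / (s + t)) *\<^sub>R b"
      have "?c \<in> K"
        using s t ab by (intro convexD[OF conv]) (auto simp: add_divide_distrib[symmetric])
      moreover have "(s + t) / 2 * (s / (s + t)) = s / 2" "(s + t) / 2 * (t / (s + t)) = t / 2"
        using s t by (auto simp: field_simps)
      then have "(1 / 2) *\<^sub>R (x + y) = ((s + t) / 2) *\<^sub>R ?c"
        by (simp only: ab scaleR_add_right scaleR_scaleR) simp
      ultimately have "(1 / 2) *\<^sub>R (x + y) \<in> (*\<^sub>R) ((s + t) / 2) ` K" by blast
      moreover have "exp (\<theta> \<bullet> x) * exp (\<theta> \<bullet> y) = (exp (\<theta> \<bullet> ((1 / 2) *\<^sub>R (x + y))))\<^sup>2"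
        by (simp add: power2_eq_square inner_add_right flip: exp_add)
      ultimately show ?thesis using True by (simp add: ennreal_mult[symmetric] ennreal_power)
    qed (auto simp: indicator_def)
  qed measurable
  then have "ennreal (F s) * ennreal (F t) \<le> (ennreal (F ((s + t) / 2)))\<^sup>2"
    using s t by (simp add: nn_integral_dilate F_def)
  moreover have "0 \<le> F r" if "0 < r" for r
    using that partition_function_pos[of "r *\<^sub>R \<theta>"] by (simp add: F_def)
  ultimately show ?thesis
    using s t by (simp add: ennreal_mult[symmetric] ennreal_power)
qed

text \<open>The second derivative at \<open>t = 1\<close> of the logarithm of \<open>t ^ DIM * partition_function (t \<theta>)\<close> is the
  left-hand side minus the dimension, and the logarithm is midpoint concave.\<close>
lemma covariance_le_DIM:
  assumes conv: "convex K"
  shows "\<theta> \<bullet> covariance \<theta> \<theta> \<le> DIM('a)"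
proof -
  let ?n = "real DIM('a)"
  define \<phi> where "\<phi> t = ?n * ln t + ln (partition_function (t *\<^sub>R \<theta>))" for t
  define \<phi>' where "\<phi>' t = ?n / t + \<theta> \<bullet> mean (t *\<^sub>R \<theta>)" for t
  have line: "((\<lambda>t. t *\<^sub>R \<theta>) has_derivative (\<lambda>s. s *\<^sub>R \<theta>)) (at t)" for t
    by (auto intro!: derivative_eq_intros)
  have der: "(\<phi> has_real_derivative \<phi>' t) (at t)" if "0 < t" for t
  proof -
    have "((\<lambda>t. ln (partition_function (t *\<^sub>R \<theta>))) has_derivative (\<lambda>s. (s *\<^sub>R \<theta>) \<bullet> mean (t *\<^sub>R \<theta>))) (at t)"
      by (rule has_derivative_compose[OF line has_derivative_ln_partition_function])
    then have "((\<lambda>t. ln (partition_function (t *\<^sub>R \<theta>))) has_real_derivative \<theta> \<bullet> mean (t *\<^sub>R \<theta>)) (at t)"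
      by (simp add: has_field_derivative_def mult_commute_abs)
    moreover have "((\<lambda>t. ?n * ln t) has_real_derivative ?n / t) (at t)"
      using that by (auto intro!: derivative_eq_intros)
    ultimately show ?thesis
      unfolding \<phi>_def \<phi>'_def by (intro DERIV_add)
  qed
  have "((\<lambda>t. \<theta> \<bullet> mean (t *\<^sub>R \<theta>)) has_derivative (\<lambda>s. \<theta> \<bullet> covariance (1 *\<^sub>R \<theta>) (s *\<^sub>R \<theta>))) (at 1)"
    by (intro has_derivative_inner_right has_derivative_compose[OF line has_derivative_mean])
  then have "((\<lambda>t. \<theta> \<bullet> mean (t *\<^sub>R \<theta>)) has_real_derivative \<theta> \<bullet> covariance \<theta> \<theta>) (at 1)"
    by (simp add: has_field_derivative_def linear_cmul[OF linear_covariance] mult_commute_abs)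
  then have der2: "(\<phi>' has_real_derivative \<theta> \<bullet> covariance \<theta> \<theta> - ?n) (at 1)"
    unfolding \<phi>'_def by (auto intro!: derivative_eq_intros)
  have "\<theta> \<bullet> covariance \<theta> \<theta> - ?n \<le> 0"
  proof (rule midpoint_concave_imp_second_derivative_nonpos[OF zero_less_one _ der2])
    show "(\<phi> has_real_derivative \<phi>' t) (at t)" if "\<bar>t - 1\<bar> < 1" for t
      using that by (intro der) auto
    fix s :: real assume s: "0 < s" "s < 1"
    define F where "F t = t ^ DIM('a) * partition_function (t *\<^sub>R \<theta>)" for t
    have ln_F: "ln (F t) = \<phi> t" and F_pos: "0 < F t" if "0 < t" for t
      using that partition_function_pos[of "t *\<^sub>R \<theta>"] by (simp_all add: F_def \<phi>_def ln_mult ln_realpow)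
    have "F (1 + s) * F (1 - s) \<le> (F 1)\<^sup>2"
      using dilated_partition_function_log_concave[OF conv, of "1 + s" "1 - s" \<theta>] s by (simp add: F_def)
    then have "ln (F (1 + s) * F (1 - s)) \<le> ln ((F 1)\<^sup>2)"
      using F_pos[of "1 + s"] F_pos[of "1 - s"] F_pos[of 1] s by (subst ln_le_cancel_iff) simp_all
    then show "\<phi> (1 + s) + \<phi> (1 - s) \<le> 2 * \<phi> 1"
      using F_pos[of "1 + s"] F_pos[of "1 - s"] F_pos[of 1] s by (simp add: ln_mult ln_realpow ln_F)
  qed
  then show ?thesis by simp
qed

section \<open>The Legendre dual point\<close>

text \<open>The ball of radius \<open>r / 4\<close> whose centre is \<open>x\<close> moved by \<open>r / 2\<close> in the direction of \<open>\<theta>\<close> still lies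
  in \<open>K\<close>, and there \<open>\<theta> \<bullet> z\<close> exceeds \<open>\<theta> \<bullet> x\<close> by at least \<open>r / 4 * norm \<theta>\<close>. This makes the function maximized
  in the Fenchel conjugate at \<open>x\<close> tend to minus infinity as \<open>\<theta>\<close> grows.\<close>
lemma partition_function_lower_bound:
  assumes r: "0 < r" and K: "cball x r \<subseteq> K"
  obtains c where "0 < c" "\<And>\<theta>. c * exp (\<theta> \<bullet> x + r / 4 * norm \<theta>) \<le> partition_function \<theta>"
proof
  let ?c = "measure lborel (ball (0 :: 'a) (r / 4))"
  show "0 < ?c" using r by (simp add: content_ball_pos)
  fix \<theta> :: 'a
  define y where "y = x + (r / 2) *\<^sub>R sgn \<theta>"
  have "measure lborel (ball y (r / 4)) = ?c" using r by (simp add: content_ball)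
  then have "?c * exp (\<theta> \<bullet> x + r / 4 * norm \<theta>)
      = (\<integral>z. indicator (ball y (r / 4)) z * exp (\<theta> \<bullet> x + r / 4 * norm \<theta>) \<partial>lborel)"
    by simp
  also have "\<dots> \<le> (\<integral>z. indicator K z *\<^sub>R exp (\<theta> \<bullet> z) *\<^sub>R 1 \<partial>lborel)"
  proof (rule integral_mono)
    show "integrable lborel (\<lambda>z. indicator (ball y (r / 4)) z * exp (\<theta> \<bullet> x + r / 4 * norm \<theta>))"
      using emeasure_lborel_ball_finite[of y "r / 4"] by (intro integrable_mult_left) (simp add: integrable_indicator_iff)
    show "integrable lborel (\<lambda>z. indicator K z *\<^sub>R exp (\<theta> \<bullet> z) *\<^sub>R (1 :: real))"
      by (intro borel_integrable_compact compact continuous_intros)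
    fix z
    show "indicator (ball y (r / 4)) z * exp (\<theta> \<bullet> x + r / 4 * norm \<theta>) \<le> indicator K z *\<^sub>R exp (\<theta> \<bullet> z) *\<^sub>R 1"
    proof (cases "z \<in> ball y (r / 4)")
      case True
      then have z: "norm (z - y) < r / 4" by (simp add: dist_norm norm_minus_commute)
      have "norm (y - x) \<le> r / 2" using r by (simp add: y_def norm_sgn)
      then have "norm (z - x) \<le> r"
        using z r norm_triangle_ineq[of "z - y" "y - x"] by simp
      then have "z \<in> K" using K by (auto simp: dist_norm norm_minus_commute)
      have "\<theta> \<bullet> sgn \<theta> = norm \<theta>"
        by (cases "\<theta> = 0") (simp_all add: sgn_div_norm dot_square_norm power2_eq_square)
      then have "\<theta> \<bullet> y = \<theta> \<bullet> x + r / 2 * norm \<theta>"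
        by (simp add: y_def inner_add_right)
      moreover have "\<bar>\<theta> \<bullet> (z - y)\<bar> \<le> r / 4 * norm \<theta>"
        using Cauchy_Schwarz_ineq2[of \<theta> "z - y"] mult_left_mono[of "norm (z - y)" "r / 4" "norm \<theta>"] z by (simp add: mult.commute)
      ultimately have "\<theta> \<bullet> x + r / 4 * norm \<theta> \<le> \<theta> \<bullet> z"
        unfolding inner_diff_right by linarith
      then show ?thesis using True \<open>z \<in> K\<close> by simp
    qed simp
  qed
  also have "\<dots> = partition_function \<theta>"
    by (simp add: partition_function_def tilted_integral_def set_lebesgue_integral_def)
  finally show "?c * exp (\<theta> \<bullet> x + r / 4 * norm \<theta>) \<le> partition_function \<theta>" .
qed

text \<open>By coercivity the maximum is attained on a large ball, and at a maximum the gradient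
  \<open>x - mean \<theta>\<close> vanishes.\<close>
lemma legendre_maximum:
  assumes x: "x \<in> interior K"
  obtains \<theta> where "mean \<theta> = x"
    "\<And>\<eta>. \<eta> \<bullet> x - ln (partition_function \<eta>) \<le> \<theta> \<bullet> x - ln (partition_function \<theta>)"
proof -
  let ?g = "\<lambda>\<theta>. \<theta> \<bullet> x - ln (partition_function \<theta>)"
  have der: "(?g has_derivative (\<lambda>h. h \<bullet> x - h \<bullet> mean \<theta>)) (at \<theta>)" for \<theta>
    by (intro has_derivative_diff has_derivative_inner_left has_derivative_ident
        has_derivative_ln_partition_function)
  obtain r where r: "0 < r" "cball x r \<subseteq> K"
    using x by (auto simp: mem_interior_cball)
  obtain c where c: "0 < c" "\<And>\<theta>. c * exp (\<theta> \<bullet> x + r / 4 * norm \<theta>) \<le> partition_function \<theta>"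
    using partition_function_lower_bound[OF r] by blast
  have upper: "?g \<theta> \<le> - (r / 4 * norm \<theta>) - ln c" for \<theta>
  proof -
    have "ln (c * exp (\<theta> \<bullet> x + r / 4 * norm \<theta>)) \<le> ln (partition_function \<theta>)"
      using c partition_function_pos by simp
    then show ?thesis using c(1) by (simp add: ln_mult)
  qed
  \<comment> \<open>Outside the ball of radius \<open>R\<close> the upper bound is at most the value at \<open>0\<close>.\<close>
  define R where "R = max 0 (- 4 / r * (ln c + ?g 0))"
  have ne: "cball 0 R \<noteq> {}" by (simp add: R_def)
  have cont: "continuous_on (cball 0 R) ?g"
    using has_derivative_continuous[OF der] by (intro continuous_at_imp_continuous_on) blast
  obtain \<theta> where \<theta>: "\<And>\<eta>. \<eta> \<in> cball 0 R \<Longrightarrow> ?g \<eta> \<le> ?g \<theta>"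
    using continuous_attains_sup[OF compact_cball ne cont] by blast
  have max: "?g \<eta> \<le> ?g \<theta>" for \<eta>
  proof (cases "\<eta> \<in> cball 0 R")
    case False
    then have "- 4 / r * (ln c + ?g 0) \<le> norm \<eta>" by (simp add: R_def)
    then have "- (r / 4 * norm \<eta>) - ln c \<le> ?g 0" using r(1) by (simp add: field_simps)
    also have "?g 0 \<le> ?g \<theta>" by (rule \<theta>) (simp add: R_def)
    finally show ?thesis using upper[of \<eta>] by linarith
  qed (rule \<theta>)
  have "(\<lambda>h. h \<bullet> x - h \<bullet> mean \<theta>) = (\<lambda>h. 0)"
    by (rule differential_zero_maxmin[OF UNIV_I open_UNIV der]) (use max in blast)
  then have "\<forall>h. h \<bullet> x = h \<bullet> mean \<theta>" by (metis eq_iff_diff_eq_0)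
  then have "mean \<theta> = x" by (metis vector_eq_ldot)
  with max show ?thesis by (rule that[rotated])
qed

text \<open>On the interior of \<open>K\<close> this is the maximizer in the Fenchel conjugate, and hence the gradient of
  the entropic barrier.\<close>
definition dual_point :: "'a \<Rightarrow> 'a" where
  "dual_point = inv mean"

lemma dual_point_mean [simp]: "dual_point (mean \<theta>) = \<theta>"
  by (simp add: dual_point_def inv_f_f[OF inj_mean])

lemma mean_dual_point: "x \<in> interior K \<Longrightarrow> mean (dual_point x) = x"
  by (metis legendre_maximum dual_point_mean)

lemma dual_point_maximum:
  "x \<in> interior K \<Longrightarrow>
    \<eta> \<bullet> x - ln (partition_function \<eta>) \<le> dual_point x \<bullet> x - ln (partition_function (dual_point x))"
  by (metis legendre_maximum dual_point_mean)

lemma bij_covariance: "bij (covariance \<theta>)"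
proof -
  have "inj (covariance \<theta>)"
    using covariance_pos[of _ \<theta>] by (subst linear_injective_0[OF linear_covariance]) force
  then show ?thesis
    using linear_covariance linear_injective_imp_surjective by (auto simp: bij_def)
qed

lemma has_derivative_dual_point:
  "(dual_point has_derivative inv (covariance \<theta>)) (at (mean \<theta>))"
proof (rule has_derivative_inverse_strong[OF open_UNIV UNIV_I, where f = mean and x = \<theta>])
  show "continuous_on UNIV mean"
    using has_derivative_continuous[OF has_derivative_mean] by (intro continuous_at_imp_continuous_on) blast
  show "covariance \<theta> \<circ> inv (covariance \<theta>) = id"
    using bij_covariance[of \<theta>] by (simp add: bij_def surj_iff)
qed (simp_all add: has_derivative_mean)

text \<open>The envelope property: the contributions of the moving maximizer cancel because \<open>mean\<close> of
  \<open>dual_point x\<close> is \<open>x\<close>, so \<open>dual_point x\<close> itself is the gradient.\<close>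
lemma has_derivative_conjugate:
  assumes x: "x \<in> interior K"
  shows "((\<lambda>y. dual_point y \<bullet> y - ln (partition_function (dual_point y))) has_derivative (\<lambda>h. h \<bullet> dual_point x)) (at x)"
proof -
  let ?\<theta> = "dual_point x"
  have D: "(dual_point has_derivative inv (covariance ?\<theta>)) (at x)"
    using has_derivative_dual_point[of ?\<theta>] mean_dual_point[OF x] by simp
  have "((\<lambda>y. dual_point y \<bullet> y - ln (partition_function (dual_point y))) has_derivative
      (\<lambda>h. (?\<theta> \<bullet> h + inv (covariance ?\<theta>) h \<bullet> x) - inv (covariance ?\<theta>) h \<bullet> mean ?\<theta>)) (at x)"
    by (intro has_derivative_diff has_derivative_inner has_derivative_ident D
        has_derivative_compose[OF D has_derivative_ln_partition_function])
  then show ?thesis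
    by (simp add: mean_dual_point[OF x] inner_commute)
qed

text \<open>With \<open>v = covariance \<theta> w\<close>, Cauchy--Schwarz for the covariance of \<open>w\<close> and \<open>\<theta>\<close> reduces the claim
  to the bound on the variance in the direction \<open>\<theta>\<close>.\<close>
lemma inverse_covariance_ge:
  assumes "convex K"
  shows "(v \<bullet> \<theta>)\<^sup>2 / DIM('a) \<le> v \<bullet> inv (covariance \<theta>) v"
proof -
  define w where "w = inv (covariance \<theta>) v"
  have v: "v = covariance \<theta> w"
    using bij_covariance[of \<theta>] by (simp add: w_def bij_def surj_f_inv_f)
  have nonneg: "0 \<le> w \<bullet> covariance \<theta> w"
    using covariance_pos[of w \<theta>] by (cases "w = 0") auto
  have "(v \<bullet> \<theta>)\<^sup>2 = (\<theta> \<bullet> covariance \<theta> w)\<^sup>2" by (simp add: v inner_commute)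
  also have "\<dots> \<le> (\<theta> \<bullet> covariance \<theta> \<theta>) * (w \<bullet> covariance \<theta> w)"
    by (rule covariance_Cauchy_Schwarz)
  also have "\<dots> \<le> DIM('a) * (w \<bullet> covariance \<theta> w)"
    using covariance_le_DIM[OF assms] nonneg by (rule mult_right_mono)
  finally show ?thesis
    by (simp add: v[symmetric] w_def[symmetric] inner_commute field_simps)
qed

lemma inverse_covariance_symmetric:
  "u \<bullet> inv (covariance \<theta>) v = inv (covariance \<theta>) u \<bullet> v"
proof -
  have "\<And>v. covariance \<theta> (inv (covariance \<theta>) v) = v"
    using bij_covariance[of \<theta>] by (simp add: bij_def surj_f_inv_f)
  then show ?thesis
    using covariance_symmetric[of "inv (covariance \<theta>) v" \<theta> "inv (covariance \<theta>) u"] by (simp add: inner_commute)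
qed

end

section \<open>Self-concordance of the entropic barrier\<close>

lemma gradient_eqI: "GDERIV f x :> D \<Longrightarrow> gradient f x = D"
proof -
  assume D: "GDERIV f x :> D"
  have "f differentiable (at x)" using D by (auto simp: gderiv_def differentiable_def)
  from GDERIV_gradient[OF this] D show ?thesis
    by (simp add: gderiv_def) (metis has_derivative_unique vector_eq_ldot)
qed

theorem theorem2:
  fixes K :: "(real ^ 'n) set"
  assumes "convex_body K"
  shows "(\<forall>x\<in>interior K. \<bar>fenchel_conjugate (log_laplace K) x\<bar> \<noteq> \<infinity>) \<and>
    self_concordant_barrier (real CARD('n)) (interior K) (entropic_barrier K)"
proof -
  interpret compact_body K using assms by unfold_locales (auto simp: convex_body_def)
  have conv: "convex K" using assms by (simp add: convex_body_def)
  let ?b = "\<lambda>x. dual_point x \<bullet> x - ln (partition_function (dual_point x))"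
  have ll: "log_laplace K = (\<lambda>\<theta>. ln (partition_function \<theta>))"
    by (simp add: log_laplace_def[abs_def] partition_function_def tilted_integral_def)
  have conj: "fenchel_conjugate (log_laplace K) x = ereal (?b x)" if "x \<in> interior K" for x
    unfolding fenchel_conjugate_def ll
    by (intro antisym SUP_least SUP_upper2[of "dual_point x"]) (use dual_point_maximum[OF that] in auto)
  then have eb: "?b x = entropic_barrier K x" if "x \<in> interior K" for x
    using that by (simp add: entropic_barrier_def)
  have der: "GDERIV (entropic_barrier K) x :> dual_point x" if "x \<in> interior K" for x
    unfolding gderiv_def
    using has_derivative_transform_within_open[OF has_derivative_conjugate[OF that] open_interior that eb] .
  have grad: "dual_point x = gradient (entropic_barrier K) x" if "x \<in> interior K" for x
    by (rule gradient_eqI[OF der[OF that], symmetric])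
  have der_grad: "(gradient (entropic_barrier K) has_derivative inv (covariance (dual_point x))) (at x)"
    if "x \<in> interior K" for x
    using has_derivative_transform_within_open[OF _ open_interior that grad]
      has_derivative_dual_point[of "dual_point x"] mean_dual_point[OF that] by simp
  have hess: "hessian (entropic_barrier K) x *v v = inv (covariance (dual_point x)) v" if "x \<in> interior K" for x v
  proof -
    have "frechet_derivative (gradient (entropic_barrier K)) (at x) = inv (covariance (dual_point x))"
      using frechet_derivative_at[OF der_grad[OF that]] by simp
    then show ?thesis
      using has_derivative_linear[OF der_grad[OF that]] by (simp add: hessian_def jacobian_def matrix_works)
  qed
  have outer: "outer_product u u *v v = (u \<bullet> v) *\<^sub>R u" for u v :: "real ^ 'n"
    by (simp add: vec_eq_iff matrix_vector_mult_def outer_product_nth inner_vec_def sum_distrib_left mult_ac)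
  have "positive_semidefinite (hessian (entropic_barrier K) x - (1 / real CARD('n)) *\<^sub>R
      outer_product (gradient (entropic_barrier K) x) (gradient (entropic_barrier K) x))"
    if x: "x \<in> interior K" for x
  proof -
    let ?\<theta> = "dual_point x"
    let ?A = "hessian (entropic_barrier K) x - (1 / real CARD('n)) *\<^sub>R outer_product ?\<theta> ?\<theta>"
    have A: "?A *v v = inv (covariance ?\<theta>) v - ((?\<theta> \<bullet> v) / CARD('n)) *\<^sub>R ?\<theta>" for v
      by (simp add: matrix_vector_mult_diff_rdistrib hess[OF x] scaleR_matrix_vector_assoc[symmetric] outer)
    have "u \<bullet> (transpose ?A *v v) = u \<bullet> (?A *v v)" for u v
    proof -
      have "u \<bullet> (transpose ?A *v v) = v \<bullet> (?A *v u)"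
        by (simp only: transpose_matrix_vector inner_commute[of u] dot_lmul_matrix)
      also have "\<dots> = u \<bullet> (?A *v v)"
        using inverse_covariance_symmetric[of u ?\<theta> v]
        by (simp add: A inner_diff_right inner_commute mult_ac)
      finally show ?thesis .
    qed
    then have "transpose ?A = ?A"
      by (simp add: matrix_eq) (metis vector_eq_ldot)
    moreover have "0 \<le> v \<bullet> (?A *v v)" for v
      using inverse_covariance_ge[OF conv, of v ?\<theta>]
      by (simp add: A inner_diff_right power2_eq_square inner_commute)
    ultimately show ?thesis by (simp add: positive_semidefinite_def grad[OF x, symmetric])
  qed
  moreover have "twice_differentiable_on (entropic_barrier K) (interior K)"
    using der der_grad by (auto simp: twice_differentiable_on_def gderiv_def differentiable_def)
  ultimately show ?thesis
    using conj by (simp add: self_concordant_barrier_def)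
qed

end
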